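(* Let $D$ be a weighted oriented graph such that at most one edge is oriented into each vertex and, for all $x\in V(D)$, $w(x)\geq 2$ if $\deg_D(x)\geq 2$. Let $x_{i_1},\ldots,x_{i_s}$ be distinct vertices of $D$ and $w_{i_j}=w(x_{i_j})$. Then $I(D)\subseteq (x_{i_1}^{w_{i_1}},\ldots,x_{i_s}^{w_{i_s}})$ with $s$ the least possible value (in the sense that $I(D)$ is not contained in $(x^{w(x)}\mid x\in S)$ for any proper subset $S\subsetneq\{x_{i_1},\ldots,x_{i_s}\}$) if and only if $\{x_{i_1},\ldots,x_{i_s}\}$ is a maximal strong vertex cover of $D$.
   Context: A weighted oriented graph $D=(V(D),E(D),w)$ has a finite simple underlying graph (assumed connected), each edge $\{x,y\}$ given exactly one orientation, $(x,y)\in E(D)$ meaning $x\to y$, and a weight function $w:V(D)\to\mathbb N=\{1,2,\ldots\}$. Convention: every source vertex (a vertex with no incoming edge) has weight $1$. Let $k$ be a field; vertices are identified with variables of a polynomial ring $R$ over $k$. The edge ideal is $I(D)=(xy^{w(y)}\mid (x,y)\in E(D))\subseteq R$. $N_D^+(x)=\{y\mid (x,y)\in E(D)\}$, $N_D^-(x)=\{y\mid (y,x)\in E(D)\}$, $N_D(x)=N_D^+(x)\cup N_D^-(x)$, $\deg_D(x)=|N_D(x)|$, and $V^+(D)$ is the set of vertices with $w\neq 1$. A vertex cover of $D$ is a set $C\subseteq V(D)$ such that for each $(x,y)\in E(D)$, $x\in C$ or $y\in C$. With $C^c=V(D)\setminus C$ put $L_1^D(C)=\{x\in C\mid N_D^+(x)\cap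 C^c\neq\emptyset\}$, $L_2^D(C)=\{x\in C\mid x\notin L_1^D(C),\ N_D^-(x)\cap C^c\neq\emptyset\}$, $L_3^D(C)=C\setminus(L_1^D(C)\cup L_2^D(C))$. A vertex cover $C$ is strong if for each $x\in L_3^D(C)$ there is $(y,x)\in E(D)$ with $y\in L_2^D(C)\cup L_3^D(C)$ and $y\in V^+(D)$. A strong vertex cover is maximal if it is not contained in any other strong vertex cover of $D$. *)

theory Defs
  imports Complex_Main "HOL-Library.Poly_Mapping"
begin

text \<open>
  A weighted oriented graph: the vertices are all elements of the finite type \<open>'v\<close>,
  \<open>(x, y) \<in> E\<close> is the oriented edge from \<open>x\<close> to \<open>y\<close>, and \<open>w\<close> is the weight function.
  Asymmetry of \<open>E\<close> says both that there are no loops and that every edge of the (simple)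
  underlying graph carries exactly one orientation.
\<close>

locale weighted_oriented_graph =
  fixes E :: "('v::finite \<times> 'v) set"
    and w :: "'v \<Rightarrow> nat"
  assumes oriented: "asym E"
    and connected: "\<And>x y. (x, y) \<in> (E \<union> E\<inverse>)\<^sup>*"
    and weight_pos: "\<And>x. w x \<ge> 1"
    and source_weight: "\<And>x. (\<forall>y. (y, x) \<notin> E) \<Longrightarrow> w x = 1"

definition out_nbrs :: "('v \<times> 'v) set \<Rightarrow> 'v \<Rightarrow> 'v set" where
  "out_nbrs E x = {y. (x, y) \<in> E}"

definition in_nbrs :: "('v \<times> 'v) set \<Rightarrow> 'v \<Rightarrow> 'v set" where
  "in_nbrs E x = {y. (y, x) \<in> E}"

definition nbrs :: "('v \<times> 'v) set \<Rightarrow> 'v \<Rightarrow> 'v set" where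
  "nbrs E x = out_nbrs E x \<union> in_nbrs E x"

definition degree :: "('v \<times> 'v) set \<Rightarrow> 'v \<Rightarrow> nat" where
  "degree E x = card (nbrs E x)"

definition V_plus :: "('v \<Rightarrow> nat) \<Rightarrow> 'v set" where
  "V_plus w = {x. w x \<noteq> 1}"

definition vertex_cover :: "('v \<times> 'v) set \<Rightarrow> 'v set \<Rightarrow> bool" where
  "vertex_cover E C \<longleftrightarrow> (\<forall>(x, y) \<in> E. x \<in> C \<or> y \<in> C)"

definition L1 :: "('v \<times> 'v) set \<Rightarrow> 'v set \<Rightarrow> 'v set" where
  "L1 E C = {x \<in> C. out_nbrs E x \<inter> (- C) \<noteq> {}}"

definition L2 :: "('v \<times> 'v) set \<Rightarrow> 'v set \<Rightarrow> 'v set" where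
  "L2 E C = {x \<in> C. x \<notin> L1 E C \<and> in_nbrs E x \<inter> (- C) \<noteq> {}}"

definition L3 :: "('v \<times> 'v) set \<Rightarrow> 'v set \<Rightarrow> 'v set" where
  "L3 E C = C - (L1 E C \<union> L2 E C)"

definition strong_vertex_cover :: "('v \<times> 'v) set \<Rightarrow> ('v \<Rightarrow> nat) \<Rightarrow> 'v set \<Rightarrow> bool" where
  "strong_vertex_cover E w C \<longleftrightarrow>
     vertex_cover E C \<and>
     (\<forall>x \<in> L3 E C. \<exists>y. (y, x) \<in> E \<and> y \<in> L2 E C \<union> L3 E C \<and> y \<in> V_plus w)"

definition maximal_strong_vertex_cover ::
    "('v \<times> 'v) set \<Rightarrow> ('v \<Rightarrow> nat) \<Rightarrow> 'v set \<Rightarrow> bool" where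
  "maximal_strong_vertex_cover E w C \<longleftrightarrow>
     strong_vertex_cover E w C \<and> (\<nexists>C'. strong_vertex_cover E w C' \<and> C \<subset> C')"

text \<open>
  The polynomial ring over \<open>'k\<close> whose variables are the elements of \<open>'v\<close>: finitely supported
  maps from exponent vectors to coefficients.
\<close>

type_synonym ('v, 'k) mpoly = "('v \<Rightarrow>\<^sub>0 nat) \<Rightarrow>\<^sub>0 'k"

definition Var :: "'v \<Rightarrow> ('v, 'k::field) mpoly" where
  "Var x = Poly_Mapping.single (Poly_Mapping.single x 1) 1"

text \<open>
  A commutative ring is a module over itself; its submodules are its ideals, so the span of a
  set is the ideal generated by it.
\<close>

global_interpretation ideal: module "(*) :: 'a::comm_ring_1 \<Rightarrow> 'a \<Rightarrow> 'a"
  defines ideal = ideal.span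
  by standard (simp_all add: algebra_simps)

definition edge_ideal :: "('v \<times> 'v) set \<Rightarrow> ('v \<Rightarrow> nat) \<Rightarrow> ('v, 'k::field) mpoly set" where
  "edge_ideal E w = ideal {Var x * Var y ^ w y | x y. (x, y) \<in> E}"

definition weighted_var_ideal :: "('v \<Rightarrow> nat) \<Rightarrow> 'v set \<Rightarrow> ('v, 'k::field) mpoly set" where
  "weighted_var_ideal w S = ideal {Var x ^ w x | x. x \<in> S}"

end

theory Submission
  imports Defs
begin

text \<open>
  Divisibility of monomials turns the containment of ideals into combinatorics: the generator
  \<open>x y\<^bsup>w(y)\<^esup>\<close> lies in the ideal of \<open>S\<close> iff \<open>y \<in> S\<close>, or \<open>x \<in> S\<close> and \<open>w x = 1\<close>
  (\<open>edge_ideal_subset_iff\<close>).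

  The degree hypothesis makes weight one very rare.  If \<open>(x, y)\<close> is an edge and \<open>w x = 1\<close>, then
  \<open>x\<close> has degree one, so \<open>x\<close> is a source and \<open>y\<close> is its only neighbour.  Thus an edge
  whose tail is not a source forces its head into \<open>S\<close>, whereas an edge leaving a source can be
  served by either end.  A minimal \<open>S\<close> therefore contains every vertex with a non-source
  predecessor, and exactly one of the two ends of each edge that leaves a source.

  Strong vertex covers meet the same sources from the other side.  A source has no incoming
  edge, so if a strong cover contains it, this must be because its successor is left out: the
  cover has at most one end of an edge leaving a source.  Nothing else bounds a strong cover from
  above, since a vertex with a non-source predecessor can always be added: that predecessor has
  weight at least two and supports it.  So the maximal strong covers are described by the
  condition found for the minimal \<open>S\<close>.  This common condition is \<open>source_balanced\<close>, and the
  theorem combines \<open>minimal_head_dominating_iff\<close> with \<open>maximal_strong_vertex_cover_iff\<close>.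
\<close>

section \<open>Membership in ideals generated by powers of variables\<close>

lemma Var_power: "(Var x :: ('v, 'k::field) mpoly) ^ n = Poly_Mapping.single (Poly_Mapping.single x n) 1"
proof (induction n)
  case 0
  show ?case by simp
next
  case (Suc n)
  have "(Var x :: ('v, 'k) mpoly) ^ Suc n = Var x * Poly_Mapping.single (Poly_Mapping.single x n) 1"
    using Suc by simp
  then show ?case
    by (simp add: Var_def mult_single single_add[symmetric])
qed

lemma keys_edge_monomial:
  "Poly_Mapping.keys (Var x * Var y ^ n :: ('v, 'k::field) mpoly) =
     {Poly_Mapping.single x 1 + Poly_Mapping.single y n}"
  by (simp add: Var_power) (simp add: Var_def mult_single)

text \<open>
  Every monomial of every member is divisible by some generator, because the
  polynomials with this property form an ideal.
\<close>

lemma weighted_var_ideal_keys: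
  fixes p :: "('v, 'k::field) mpoly"
  assumes "p \<in> weighted_var_ideal w S" and "m \<in> Poly_Mapping.keys p"
  shows "\<exists>z\<in>S. w z \<le> Poly_Mapping.lookup m z"
proof -
  let ?Q = "\<lambda>p :: ('v, 'k) mpoly.
    \<forall>m \<in> Poly_Mapping.keys p. \<exists>z\<in>S. w z \<le> Poly_Mapping.lookup m z"
  have "p \<in> ideal.span {Var x ^ w x | x. x \<in> S}"
    using assms(1) by (simp add: weighted_var_ideal_def)
  then have "?Q p"
  proof (induction rule: ideal.span_induct)
    case base
    have add: "?Q (a + b)" if "?Q a" "?Q b" for a b
      using that Poly_Mapping.keys_add[of a b] by blast
    have scale: "?Q (c * a)" if "?Q a" for c a
    proof
      fix m assume "m \<in> Poly_Mapping.keys (c * a)"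
      then obtain m1 m2 where "m = m1 + m2" "m2 \<in> Poly_Mapping.keys a"
        using Poly_Mapping.keys_mult[of c a] by blast
      then show "\<exists>z\<in>S. w z \<le> Poly_Mapping.lookup m z"
        using that by (fastforce simp: lookup_add intro: trans_le_add2)
    qed
    show ?case
    proof (rule ideal.subspaceI)
      show "0 \<in> Collect ?Q" by simp
      show "a + b \<in> Collect ?Q" if "a \<in> Collect ?Q" "b \<in> Collect ?Q" for a b
        using add that unfolding mem_Collect_eq .
      show "c * a \<in> Collect ?Q" if "a \<in> Collect ?Q" for c a
        using scale that unfolding mem_Collect_eq .
    qed
  next
    case (step p)
    then obtain x where "x \<in> S" "p = Var x ^ w x" by blast
    then show ?case by (auto simp: Var_power intro!: bexI[of _ x])
  qed
  then show ?thesis using assms(2) by blast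
qed

definition head_dominating :: "('v \<times> 'v) set \<Rightarrow> ('v \<Rightarrow> nat) \<Rightarrow> 'v set \<Rightarrow> bool" where
  "head_dominating E w S \<longleftrightarrow> (\<forall>x y. (x, y) \<in> E \<longrightarrow> y \<in> S \<or> x \<in> S \<and> w x = 1)"

lemma edge_monomial_mem_iff:
  assumes "x \<noteq> y" and "\<And>z. w z \<ge> 1"
  shows "(Var x * Var y ^ w y :: ('v, 'k::field) mpoly) \<in> weighted_var_ideal w S
         \<longleftrightarrow> y \<in> S \<or> x \<in> S \<and> w x = 1"
proof
  assume "(Var x * Var y ^ w y :: ('v, 'k) mpoly) \<in> weighted_var_ideal w S"
  from weighted_var_ideal_keys[OF this] obtain z where z: "z \<in> S"
    "w z \<le> Poly_Mapping.lookup (Poly_Mapping.single x 1 + Poly_Mapping.single y (w y)) z"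
    unfolding keys_edge_monomial by blast
  then show "y \<in> S \<or> x \<in> S \<and> w x = 1"
    using assms(1) assms(2)[of z]
    by (auto simp: lookup_add lookup_single when_def split: if_splits)
next
  have gen: "Var z ^ w z \<in> (weighted_var_ideal w S :: ('v, 'k) mpoly set)" if "z \<in> S" for z
    using that unfolding weighted_var_ideal_def by (blast intro: ideal.span_base)
  have mult: "q * p \<in> weighted_var_ideal w S"
    if "p \<in> weighted_var_ideal w S" for p q :: "('v, 'k) mpoly"
    using that unfolding weighted_var_ideal_def by (rule ideal.span_scale)
  assume "y \<in> S \<or> x \<in> S \<and> w x = 1"
  then show "(Var x * Var y ^ w y :: ('v, 'k) mpoly) \<in> weighted_var_ideal w S"
    using mult[OF gen[of y], of "Var x"] mult[OF gen[of x], of "Var y ^ w y"]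
    by (auto simp: mult.commute)
qed

lemma edge_ideal_subset_iff:
  assumes "weighted_oriented_graph E w"
  shows "(edge_ideal E w :: ('v::finite, 'k::field) mpoly set) \<subseteq> weighted_var_ideal w S
         \<longleftrightarrow> head_dominating E w S"
proof -
  interpret weighted_oriented_graph E w by (fact assms)
  let ?G = "{Var x * Var y ^ w y | x y. (x, y) \<in> E} :: ('v, 'k) mpoly set"
  have "edge_ideal E w \<subseteq> (weighted_var_ideal w S :: ('v, 'k) mpoly set)
        \<longleftrightarrow> ?G \<subseteq> weighted_var_ideal w S"
  proof
    assume "edge_ideal E w \<subseteq> (weighted_var_ideal w S :: ('v, 'k) mpoly set)"
    then show "?G \<subseteq> weighted_var_ideal w S"
      using ideal.span_superset[of ?G] unfolding edge_ideal_def by (rule order_trans[rotated])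
  next
    assume "?G \<subseteq> weighted_var_ideal w S"
    then show "edge_ideal E w \<subseteq> (weighted_var_ideal w S :: ('v, 'k) mpoly set)"
      unfolding edge_ideal_def weighted_var_ideal_def
      by (rule ideal.span_minimal) (rule ideal.subspace_span)
  qed
  also have "\<dots> \<longleftrightarrow> (\<forall>x y. (x, y) \<in> E \<longrightarrow>
      (Var x * Var y ^ w y :: ('v, 'k) mpoly) \<in> weighted_var_ideal w S)"
    by blast
  also have "\<dots> \<longleftrightarrow> head_dominating E w S"
  proof -
    have "(Var x * Var y ^ w y :: ('v, 'k) mpoly) \<in> weighted_var_ideal w S
          \<longleftrightarrow> y \<in> S \<or> x \<in> S \<and> w x = 1" if "(x, y) \<in> E" for x y
    proof (rule edge_monomial_mem_iff[OF _ weight_pos])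
      show "x \<noteq> y" using that oriented by (auto dest: asymD)
    qed
    then show ?thesis by (simp add: head_dominating_def)
  qed
  finally show ?thesis .
qed

section \<open>Sources and the balance condition\<close>

definition source :: "('v \<times> 'v) set \<Rightarrow> 'v \<Rightarrow> bool" where
  "source E x \<longleftrightarrow> (\<forall>y. (y, x) \<notin> E)"

text \<open>
  The second clause says for a source of degree one that exactly one end of its edge is chosen,
  and for an isolated vertex that it is not chosen.
\<close>

definition source_balanced :: "('v \<times> 'v) set \<Rightarrow> 'v set \<Rightarrow> bool" where
  "source_balanced E S \<longleftrightarrow>
     (\<forall>x y. (x, y) \<in> E \<longrightarrow> \<not> source E x \<longrightarrow> y \<in> S) \<and>
     (\<forall>x. source E x \<longrightarrow> (x \<in> S \<longleftrightarrow> (\<exists>y. (x, y) \<in> E \<and> y \<notin> S)))"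

locale heavy_in_degree_one = weighted_oriented_graph E w
  for E :: "('v::finite \<times> 'v) set" and w :: "'v \<Rightarrow> nat" +
  assumes in_degree: "\<And>x. card (in_nbrs E x) \<le> 1"
    and heavy: "\<And>x. degree E x \<ge> 2 \<Longrightarrow> w x \<ge> 2"
begin

lemma unique_predecessor: "(x, z) \<in> E \<Longrightarrow> (y, z) \<in> E \<Longrightarrow> x = y"
  using in_degree[of z] card_le_Suc0_iff_eq[of "in_nbrs E z"] by (auto simp: in_nbrs_def)

lemma source_weight_one: "source E x \<Longrightarrow> w x = 1"
  using source_weight by (simp add: source_def)

lemma two_nbrs_weight: "w x \<noteq> 1" if "y \<in> nbrs E x" "z \<in> nbrs E x" "y \<noteq> z"
proof -
  have "degree E x \<ge> 2"
    using card_mono[of "nbrs E x" "{y, z}"] that by (simp add: degree_def)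
  then show ?thesis using heavy[of x] by simp
qed

text \<open>
  Sources have weight one by convention, so the degree hypothesis leaves room for a single
  neighbour.
\<close>

lemma unique_successor_of_source:
  "source E x \<Longrightarrow> (x, y) \<in> E \<Longrightarrow> (x, z) \<in> E \<Longrightarrow> y = z"
  using two_nbrs_weight[of y x z] source_weight_one by (auto simp: nbrs_def out_nbrs_def)

text \<open>
  A vertex with both a predecessor and a successor has two distinct neighbours, as no edge
  carries both orientations.
\<close>

lemma weight_one_tail_iff: "(x, y) \<in> E \<Longrightarrow> w x = 1 \<longleftrightarrow> source E x"
proof
  assume xy: "(x, y) \<in> E" and "w x = 1"
  show "source E x"
    unfolding source_def
  proof (intro allI notI)
    fix z assume "(z, x) \<in> E"
    moreover from this have "y \<noteq> z" using xy oriented by (auto dest: asymD)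
    ultimately show False
      using two_nbrs_weight[of y x z] xy \<open>w x = 1\<close>
      by (auto simp: nbrs_def out_nbrs_def in_nbrs_def)
  qed
qed (rule source_weight_one)

section \<open>Minimal dominating sets\<close>

lemma source_balanced_imp_head_dominating:
  "source_balanced E S \<Longrightarrow> head_dominating E w S"
  unfolding source_balanced_def head_dominating_def using source_weight_one by blast

lemma source_balanced_imp_minimal:
  assumes bal: "source_balanced E S" and "T \<subset> S"
  shows "\<not> head_dominating E w T"
proof
  assume dom: "head_dominating E w T"
  from \<open>T \<subset> S\<close> obtain z where z: "z \<in> S" "z \<notin> T" by blast
  show False
  proof (cases "source E z")
    case True
    \<comment> \<open>The edge leaving \<open>z\<close> has lost its only chosen end.\<close>
    then obtain y where "(z, y) \<in> E" "y \<notin> S"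
      using bal z unfolding source_balanced_def by blast
    then show False using dom z \<open>T \<subset> S\<close> unfolding head_dominating_def by blast
  next
    case False
    then obtain x where xz: "(x, z) \<in> E" by (auto simp: source_def)
    then have "x \<in> T" "w x = 1" using dom z unfolding head_dominating_def by blast+
    then have x: "source E x" "x \<in> S" using weight_one_tail_iff[OF xz] \<open>T \<subset> S\<close> by auto
    then show False
      using bal xz z unique_successor_of_source unfolding source_balanced_def by blast
  qed
qed

lemma minimal_imp_source_balanced:
  assumes dom: "head_dominating E w S"
    and min: "\<And>T. T \<subset> S \<Longrightarrow> \<not> head_dominating E w T"
  shows "source_balanced E S"
proof -
  have "y \<in> S" if "(x, y) \<in> E" "\<not> source E x" for x y
    using that dom weight_one_tail_iff unfolding head_dominating_def by blast
  moreover have "x \<in> S \<longleftrightarrow> (\<exists>y. (x, y) \<in> E \<and> y \<notin> S)" if src: "source E x" for x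
  proof
    assume x: "x \<in> S"
    show "\<exists>y. (x, y) \<in> E \<and> y \<notin> S"
    proof (rule ccontr)
      \<comment> \<open>A source all of whose successors are chosen is redundant.\<close>
      assume all: "\<nexists>y. (x, y) \<in> E \<and> y \<notin> S"
      have "head_dominating E w (S - {x})"
        using dom all src unfolding head_dominating_def source_def by blast
      then show False using min[of "S - {x}"] x by blast
    qed
  next
    assume "\<exists>y. (x, y) \<in> E \<and> y \<notin> S"
    then show "x \<in> S" using dom unfolding head_dominating_def by blast
  qed
  ultimately show ?thesis unfolding source_balanced_def by blast
qed

theorem minimal_head_dominating_iff:
  "head_dominating E w S \<and> (\<forall>T. T \<subset> S \<longrightarrow> \<not> head_dominating E w T) \<longleftrightarrow> source_balanced E S"
  using source_balanced_imp_head_dominating source_balanced_imp_minimal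
    minimal_imp_source_balanced by blast

section \<open>Maximal strong vertex covers\<close>

text \<open>
  A source cannot satisfy the clauses for \<open>L2\<close> and \<open>L3\<close>, as both ask for an incoming edge.
\<close>

lemma strong_vertex_cover_source:
  assumes "strong_vertex_cover E w C" "source E x" "x \<in> C"
  shows "\<exists>y. (x, y) \<in> E \<and> y \<notin> C"
proof -
  have "x \<notin> L3 E C" "x \<notin> L2 E C"
    using assms unfolding strong_vertex_cover_def source_def L2_def in_nbrs_def by blast+
  then have "x \<in> L1 E C" using \<open>x \<in> C\<close> unfolding L3_def by blast
  then show ?thesis unfolding L1_def out_nbrs_def by blast
qed

lemma source_balanced_imp_strong:
  assumes bal: "source_balanced E S"
  shows "strong_vertex_cover E w S"
  unfolding strong_vertex_cover_def
proof (intro conjI ballI)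
  show "vertex_cover E S"
    using bal unfolding vertex_cover_def source_balanced_def by blast
next
  fix x assume "x \<in> L3 E S"
  then have x: "x \<in> S" "\<And>y. (x, y) \<in> E \<Longrightarrow> y \<in> S" "\<And>y. (y, x) \<in> E \<Longrightarrow> y \<in> S"
    unfolding L3_def L2_def L1_def out_nbrs_def in_nbrs_def by blast+
  then have "\<not> source E x" using bal unfolding source_balanced_def by blast
  then obtain y where yx: "(y, x) \<in> E" by (auto simp: source_def)
  \<comment> \<open>If \<open>y\<close> were a source, then both ends of its only edge would be chosen.\<close>
  have ns: "\<not> source E y"
    using bal x yx unique_successor_of_source unfolding source_balanced_def by blast
  then have "y \<notin> L1 E S"
    using bal unfolding source_balanced_def L1_def out_nbrs_def by blast
  then have "y \<in> L2 E S \<union> L3 E S" using x(3)[OF yx] unfolding L3_def by blast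
  moreover have "y \<in> V_plus w" using weight_one_tail_iff[OF yx] ns by (simp add: V_plus_def)
  ultimately show "\<exists>y. (y, x) \<in> E \<and> y \<in> L2 E S \<union> L3 E S \<and> y \<in> V_plus w"
    using yx by blast
qed

lemma source_balanced_imp_maximal:
  assumes bal: "source_balanced E S" and strong: "strong_vertex_cover E w C"
  shows "\<not> S \<subset> C"
proof
  assume SC: "S \<subset> C"
  then obtain z where z: "z \<in> C" "z \<notin> S" by blast
  show False
  proof (cases "source E z")
    case True
    then obtain y where "(z, y) \<in> E" "y \<notin> C"
      using strong_vertex_cover_source[OF strong] z by blast
    then show False using bal True z SC unfolding source_balanced_def by blast
  next
    case False
    then obtain x where xz: "(x, z) \<in> E" by (auto simp: source_def)
    then have x: "source E x" "x \<in> S"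
      using bal z unfolding source_balanced_def by blast+
    \<comment> \<open>The only successor \<open>z\<close> of the source \<open>x\<close> joins it in \<open>C\<close>.\<close>
    then obtain y where "(x, y) \<in> E" "y \<notin> C"
      using strong_vertex_cover_source[OF strong] SC by blast
    then show False using unique_successor_of_source[OF x(1) xz] z by blast
  qed
qed

text \<open>
  Every strong cover can be enlarged to a balanced set.  A successor left out next to a source
  stays out, because that source is its only predecessor.
\<close>

lemma strong_vertex_cover_extend:
  assumes strong: "strong_vertex_cover E w C"
  shows "source_balanced E (C \<union> {y. \<exists>x. (x, y) \<in> E \<and> \<not> source E x})"
    (is "source_balanced E ?C'")
proof -
  have "x \<in> ?C' \<longleftrightarrow> (\<exists>y. (x, y) \<in> E \<and> y \<notin> ?C')" if src: "source E x" for x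
  proof
    assume "x \<in> ?C'"
    then have "x \<in> C" using src by (auto simp: source_def)
    then obtain y where y: "(x, y) \<in> E" "y \<notin> C"
      using strong_vertex_cover_source[OF strong src] by blast
    then have "y \<notin> ?C'" using unique_predecessor src by blast
    then show "\<exists>y. (x, y) \<in> E \<and> y \<notin> ?C'" using y by blast
  next
    assume "\<exists>y. (x, y) \<in> E \<and> y \<notin> ?C'"
    then show "x \<in> ?C'"
      using strong unfolding strong_vertex_cover_def vertex_cover_def by blast
  qed
  then show ?thesis unfolding source_balanced_def by blast
qed

theorem maximal_strong_vertex_cover_iff:
  "maximal_strong_vertex_cover E w S \<longleftrightarrow> source_balanced E S"
proof
  assume max: "maximal_strong_vertex_cover E w S"
  let ?C = "S \<union> {y. \<exists>x. (x, y) \<in> E \<and> \<not> source E x}"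
  have bal: "source_balanced E ?C"
    using max strong_vertex_cover_extend unfolding maximal_strong_vertex_cover_def by blast
  then have "\<not> S \<subset> ?C"
    using max source_balanced_imp_strong unfolding maximal_strong_vertex_cover_def by blast
  then have "?C = S" by blast
  then show "source_balanced E S" using bal by simp
next
  assume "source_balanced E S"
  then show "maximal_strong_vertex_cover E w S"
    using source_balanced_imp_strong source_balanced_imp_maximal
    unfolding maximal_strong_vertex_cover_def by blast
qed

end

section \<open>Minimal containments and maximal strong vertex covers\<close>

theorem theorem6p5:
  fixes E :: "('v::finite \<times> 'v) set"
    and w :: "'v \<Rightarrow> nat"
    and S :: "'v set"
  assumes "weighted_oriented_graph E w"
    and "\<And>x. card (in_nbrs E x) \<le> 1"
    and "\<And>x. degree E x \<ge> 2 \<Longrightarrow> w x \<ge> 2"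
  shows "((edge_ideal E w :: ('v, 'k::field) mpoly set) \<subseteq> weighted_var_ideal w S \<and>
          (\<forall>T. T \<subset> S \<longrightarrow>
             \<not> (edge_ideal E w :: ('v, 'k) mpoly set) \<subseteq> weighted_var_ideal w T))
         \<longleftrightarrow> maximal_strong_vertex_cover E w S"
proof -
  interpret heavy_in_degree_one E w
    using assms by (simp add: heavy_in_degree_one_def heavy_in_degree_one_axioms_def)
  show ?thesis
    unfolding edge_ideal_subset_iff[OF assms(1)] minimal_head_dominating_iff
      maximal_strong_vertex_cover_iff ..
qed

end
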